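(* Fix an hour $t$ and consider the strike price optimization problem $$\begin{aligned}\max_{K_t,\,\boldsymbol r_t,\,\boldsymbol z_t}\quad & K_t\\ \text{s.t.}\quad & z_{i,t}=1\implies \underline I_{i,t}(K_t)\ge 0 && \forall i\in\mathcal G,\\ & \boldsymbol r_t\in\mathcal R_t(\boldsymbol z_t),\\ & K_t\ge 0,\\ & z_{i,t}\in\{0,1\} && \forall i\in\mathcal G,\end{aligned}$$ where the certificates $\underline I_{i,t}$, the reserve-feasibility sets $\mathcal R_t(\boldsymbol z_t)$, and the resource thresholds $\kappa_{i,t}$ are as defined in the context. If this problem is feasible and bounded (i.e. the supremum of the objective is finite), then there exists an optimal strike price $K_t^*$ satisfying $K_t^*=\kappa_{i,t}$ for some $i\in\mathcal G$ with $\kappa_{i,t}<\infty$.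
   Context: Notation: $(x)^+=\max\{x,0\}$. Data. $\mathcal G$ is a finite set of resources. $\mathcal A$ is a finite set of reserve products including TMSR, TMNSR, TMOR; $\mathcal A_i\subseteq\mathcal A$ is the set of products resource $i$ is eligible to provide. $\mathcal Q=\{\mathrm{TMSR},\mathrm{Total10},\mathrm{Total30}\}$ is the set of reserve requirement categories, with $\mathcal A_{\mathrm{TMSR}}=\{\mathrm{TMSR}\}$, $\mathcal A_{\mathrm{Total10}}=\{\mathrm{TMSR},\mathrm{TMNSR}\}$, $\mathcal A_{\mathrm{Total30}}=\{\mathrm{TMSR},\mathrm{TMNSR},\mathrm{TMOR}\}$ the products eligible to satisfy each requirement. The parameters $\mathrm{Req}_{q,t}$ (reserve requirement), $\overline R_{i,a,t}$ (maximum capability of resource $i$ for product $a$), and $\overline R_{i,30,t}$ (maximum cumulative 30-minute capability of resource $i$) are given real numbers. For $\boldsymbol z_t=(z_{i,t})_{i\in\mathcal G}$, $\mathcal R_t(\boldsymbol z_t)$ is the set of real vectors $\boldsymbol r_t=(r_{i,a,t})_{i\in\mathcal G,\,a\in\mathcal A_i}$ such that - $\sum_{i\in\mathcal G}\sum_{a\in\mathcal A_q\cap\mathcal A_i} r_{i,a,t}\ge \mathrm{Req}_{q,t}$ for all $q\in\mathcal Q$; - $0\le r_{i,a,t}\le \overline R_{i,a,t}z_{i,t}$ for all $i\in\mathcal G$, $a\in\mathcal A_i$; - $\sum_{a\in\mathcal A_{\mathrm{Total30}}\cap\mathcal A_i} r_{i,a,t}\le \overline R_{i,30,t}z_{i,t}$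 for all $i\in\mathcal G$. Certificates. $P_t$ is a real random variable (the real-time price) with $\mathbb{E}[P_t^+]<\infty$ and density $f_t$. Each resource $i$ has a marginal cost $c_{i,t}\ge 0$, a preparation cost $A_{i,t}\in\mathbb{R}$, and a price-impact bound $\phi_i\in[0,1]$, and $f_t(p)>0$ for all $p>c_{i,t}$. For $K\ge 0$, $$\underline I_{i,t}(K)=\begin{cases}\mathbb{E}[(P_t-c_{i,t})^+]-A_{i,t}, & K\le c_{i,t},\\[4pt] (1-\phi_i)\,\mathbb{E}[(P_t-c_{i,t})^+]+\phi_i\,\mathbb{E}[(P_t-K)^+]-A_{i,t}, & K>c_{i,t}.\end{cases}$$ Thresholds. For each $i$, exactly one of the following holds: (1) $\underline I_{i,t}(K)<0$ for all $K\ge 0$ (resource never certified; no threshold $\kappa_{i,t}$ is defined); (2) $\underline I_{i,t}(K)\ge 0$ for all $K\ge 0$ (always certified; $\kappa_{i,t}=\infty$); (3) there is a unique $\kappa_{i,t}\ge c_{i,t}$ with $\underline I_{i,t}(\kappa_{i,t})=0$ (finite threshold), which defines $\kappa_{i,t}<\infty$. *)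

theory Defs
  imports "HOL-Probability.Probability"
begin

(* All data refer to one fixed hour, so no hour index is carried. *)

(* The argument type of Other names the products besides the three that enter the requirements. *)
datatype 'x reserve_product = TMSR | TMNSR | TMOR | Other 'x

datatype requirement = ReqTMSR | Total10 | Total30

fun qualifying :: "requirement \<Rightarrow> 'x reserve_product set" where
  "qualifying ReqTMSR = {TMSR}"
| "qualifying Total10 = {TMSR, TMNSR}"
| "qualifying Total30 = {TMSR, TMNSR, TMOR}"

(* A vector (r_{i,a}) with i in G and a in elig i is a function that is undefined off this index
   set; elig i is the set of products resource i may provide, Rmax i a its capability for a, and
   R30 i its cumulative 30-minute capability. *)
definition reserve_feasible ::
  "'g set \<Rightarrow> ('g \<Rightarrow> 'x reserve_product set) \<Rightarrow> (requirement \<Rightarrow> real) \<Rightarrow>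
   ('g \<Rightarrow> 'x reserve_product \<Rightarrow> real) \<Rightarrow> ('g \<Rightarrow> real) \<Rightarrow> ('g \<Rightarrow> real) \<Rightarrow>
   ('g \<Rightarrow> 'x reserve_product \<Rightarrow> real) set" where
  "reserve_feasible G elig Req Rmax R30 z =
    {r \<in> (\<Pi>\<^sub>E i\<in>G. elig i \<rightarrow>\<^sub>E UNIV).
       (\<forall>q. (\<Sum>i\<in>G. \<Sum>a\<in>qualifying q \<inter> elig i. r i a) \<ge> Req q) \<and>
       (\<forall>i\<in>G. \<forall>a\<in>elig i. 0 \<le> r i a \<and> r i a \<le> Rmax i a * z i) \<and>
       (\<forall>i\<in>G. (\<Sum>a\<in>qualifying Total30 \<inter> elig i. r i a) \<le> R30 i * z i)}"

(* Certificate of a resource with marginal cost c, preparation cost A and price-impact bound \<phi>,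
   for the real-time price P on the probability space M. *)
definition certificate ::
  "'w measure \<Rightarrow> ('w \<Rightarrow> real) \<Rightarrow> real \<Rightarrow> real \<Rightarrow> real \<Rightarrow> real \<Rightarrow> real" where
  "certificate M P c A \<phi> K =
    (if K \<le> c then (\<integral>\<omega>. max (P \<omega> - c) 0 \<partial>M) - A
     else (1 - \<phi>) * (\<integral>\<omega>. max (P \<omega> - c) 0 \<partial>M) + \<phi> * (\<integral>\<omega>. max (P \<omega> - K) 0 \<partial>M) - A)"

(* None: never certified, no threshold is defined; Some \<infinity>: always certified. In the remaining case
   the zero is unique because the price has a density that is positive above c. *)
definition threshold ::
  "'w measure \<Rightarrow> ('w \<Rightarrow> real) \<Rightarrow> real \<Rightarrow> real \<Rightarrow> real \<Rightarrow> ereal option" where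
  "threshold M P c A \<phi> =
    (if \<forall>K\<ge>0. certificate M P c A \<phi> K < 0 then None
     else if \<forall>K\<ge>0. certificate M P c A \<phi> K \<ge> 0 then Some \<infinity>
     else Some (ereal (THE \<kappa>. \<kappa> \<ge> c \<and> certificate M P c A \<phi> \<kappa> = 0)))"

(* Feasible triples (K, r, z), for certificates I and reserve-feasibility sets R;
   the objective is the projection fst. *)
definition strike_feasible ::
  "'g set \<Rightarrow> ('g \<Rightarrow> real \<Rightarrow> real) \<Rightarrow> (('g \<Rightarrow> real) \<Rightarrow> 'r set) \<Rightarrow> (real \<times> 'r \<times> ('g \<Rightarrow> real)) set" where
  "strike_feasible G I R =
    {(K, r, z). (\<forall>i\<in>G. z i = 1 \<longrightarrow> I i K \<ge> 0) \<and> r \<in> R z \<and> K \<ge> 0 \<and> z \<in> G \<rightarrow>\<^sub>E {0, 1}}"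

end

theory Submission
  imports Defs
begin

text \<open>
  With a strike \<open>K\<close> above the marginal cost \<open>c\<close>, the certificate depends on \<open>K\<close> only through the
  expected payoff \<open>K \<mapsto> \<integral>(P - K)\<^sup>+\<close> of a call option with strike \<open>K\<close>. This payoff is 1-Lipschitz, and
  it is strictly decreasing above \<open>c\<close>, because the density is positive there and so \<open>P\<close> exceeds every
  such strike with positive probability. Hence a certificate that is nonnegative at some strikes and
  negative at others has exactly one zero \<open>\<kappa> \<ge> c\<close>, and the resource is certified precisely for the
  strikes up to \<open>\<kappa>\<close> (\<open>certificate_nonneg_iff_le_threshold\<close>).

  For a fixed commitment \<open>z\<close>, the strike occurs only in the certificate constraints, so a feasible
  strike can be raised, with \<open>r\<close> and \<open>z\<close> unchanged, until a committed resource is about to lose its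
  certificate, that is, to the least threshold of the committed resources. If all these thresholds
  were infinite, the objective would be unbounded (\<open>raise_to_threshold\<close>). Every feasible point is
  therefore dominated by a feasible point whose strike is a finite threshold. There are only
  finitely many thresholds, so the largest feasible one among them is optimal.
\<close>

section \<open>The expected call payoff\<close>

lemma integrable_call_payoff:
  fixes P :: "'w \<Rightarrow> real"
  assumes "prob_space M" and [measurable]: "P \<in> borel_measurable M"
    and "integrable M (\<lambda>\<omega>. max (P \<omega>) 0)"
  shows "integrable M (\<lambda>\<omega>. max (P \<omega> - K) 0)"
proof -
  interpret prob_space M by fact
  have "integrable M (\<lambda>\<omega>. max (P \<omega>) 0 + \<bar>K\<bar>)"
    using assms by auto
  then show ?thesis
    by (rule Bochner_Integration.integrable_bound) auto
qed

lemma call_payoff_antimono: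
  fixes P :: "'w \<Rightarrow> real"
  assumes "prob_space M" "P \<in> borel_measurable M" "integrable M (\<lambda>\<omega>. max (P \<omega>) 0)" "K \<le> L"
  shows "(\<integral>\<omega>. max (P \<omega> - L) 0 \<partial>M) \<le> (\<integral>\<omega>. max (P \<omega> - K) 0 \<partial>M)"
  using \<open>K \<le> L\<close> by (intro integral_mono integrable_call_payoff assms) auto

lemma call_payoff_strict_antimono:
  fixes P :: "'w \<Rightarrow> real"
  assumes "prob_space M" and [measurable]: "P \<in> borel_measurable M"
    and "integrable M (\<lambda>\<omega>. max (P \<omega>) 0)"
    and "K < L" and pos: "emeasure M {\<omega> \<in> space M. K < P \<omega>} \<noteq> 0"
  shows "(\<integral>\<omega>. max (P \<omega> - L) 0 \<partial>M) < (\<integral>\<omega>. max (P \<omega> - K) 0 \<partial>M)"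
proof -
  interpret prob_space M by fact
  show ?thesis
    using \<open>K < L\<close>
    by (intro integral_less_AE[where A = "{\<omega> \<in> space M. K < P \<omega>}"] integrable_call_payoff assms)
       (auto intro!: AE_I2)
qed

lemma call_payoff_lipschitz:
  fixes P :: "'w \<Rightarrow> real"
  assumes "prob_space M" "P \<in> borel_measurable M" "integrable M (\<lambda>\<omega>. max (P \<omega>) 0)" "K \<le> L"
  shows "(\<integral>\<omega>. max (P \<omega> - K) 0 \<partial>M) \<le> (\<integral>\<omega>. max (P \<omega> - L) 0 \<partial>M) + (L - K)"
proof -
  interpret prob_space M by fact
  note int = integrable_call_payoff[OF assms(1-3)]
  have "(\<integral>\<omega>. max (P \<omega> - K) 0 \<partial>M) \<le> (\<integral>\<omega>. max (P \<omega> - L) 0 + (L - K) \<partial>M)"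
    using \<open>K \<le> L\<close> int by (intro integral_mono) auto
  also have "\<dots> = (\<integral>\<omega>. max (P \<omega> - L) 0 \<partial>M) + (L - K)"
    using int by (simp add: prob_space)
  finally show ?thesis .
qed

lemma continuous_on_call_payoff:
  fixes P :: "'w \<Rightarrow> real"
  assumes "prob_space M" "P \<in> borel_measurable M" "integrable M (\<lambda>\<omega>. max (P \<omega>) 0)"
  shows "continuous_on S (\<lambda>K. \<integral>\<omega>. max (P \<omega> - K) 0 \<partial>M)"
proof -
  let ?g = "\<lambda>K. \<integral>\<omega>. max (P \<omega> - K) 0 \<partial>M"
  have le: "\<bar>?g K - ?g L\<bar> \<le> \<bar>K - L\<bar>" for K L
    using call_payoff_antimono[OF assms, of K L] call_payoff_antimono[OF assms, of L K]
      call_payoff_lipschitz[OF assms, of K L] call_payoff_lipschitz[OF assms, of L K]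
    by linarith
  have "1-lipschitz_on S ?g"
    by (rule lipschitz_onI) (auto simp: dist_real_def le)
  then show ?thesis
    by (rule lipschitz_on_continuous_on)
qed

lemma upper_tail_positive:
  fixes P :: "'w \<Rightarrow> real"
  assumes dist: "distributed M lborel P (\<lambda>p. ennreal (f p))"
    and pos: "\<And>p. K < p \<Longrightarrow> 0 < f p"
  shows "emeasure M {\<omega> \<in> space M. K < P \<omega>} \<noteq> 0"
proof
  have [measurable]: "(\<lambda>p. ennreal (f p)) \<in> borel_measurable lborel"
    using dist by (rule distributed_borel_measurable)
  assume "emeasure M {\<omega> \<in> space M. K < P \<omega>} = 0"
  moreover have "{\<omega> \<in> space M. K < P \<omega>} = P -` {K<..} \<inter> space M"
    by auto
  ultimately have "(\<integral>\<^sup>+p. ennreal (f p) * indicator {K<..} p \<partial>lborel) = 0"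
    using distributed_emeasure[OF dist, of "{K<..}"] by simp
  then have "AE p in lborel. ennreal (f p) * indicator {K<..} p = 0"
    by (subst (asm) nn_integral_0_iff_AE) auto
  then have "AE p in lborel. p \<notin> {K<..}"
    by eventually_elim (use pos in \<open>auto simp: indicator_def ennreal_eq_0_iff not_le split: if_splits dest: leD\<close>)
  then have "emeasure lborel {K<..} = 0"
    by (subst (asm) AE_iff_measurable[where N = "{K<..}"]) auto
  moreover have "emeasure lborel {K<..K + 1} \<le> emeasure lborel {K<..}"
    by (intro emeasure_mono) auto
  ultimately show False
    by simp
qed

section \<open>Certificates and thresholds\<close>

text \<open>
  The two branches of the certificate agree at \<open>K = c\<close>, which makes it a continuous function of the
  truncated strike \<open>max K c\<close>.
\<close>

lemma certificate_eq:
  "certificate M P c A \<phi> K =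
     (1 - \<phi>) * (\<integral>\<omega>. max (P \<omega> - c) 0 \<partial>M) + \<phi> * (\<integral>\<omega>. max (P \<omega> - max K c) 0 \<partial>M) - A"
  by (auto simp: certificate_def algebra_simps max_def)

lemma certificate_antimono:
  assumes "prob_space M" "P \<in> borel_measurable M" "integrable M (\<lambda>\<omega>. max (P \<omega>) 0)"
    and "0 \<le> \<phi>" "K \<le> L"
  shows "certificate M P c A \<phi> L \<le> certificate M P c A \<phi> K"
  unfolding certificate_eq using assms
  by (intro diff_right_mono add_left_mono mult_left_mono call_payoff_antimono) auto

text \<open>
  For \<open>\<phi> = 0\<close> the certificate is constant and cannot change sign. So a finite threshold forces
  \<open>\<phi> > 0\<close>, and then strict monotonicity above \<open>c\<close> turns the zero found by the intermediate value
  theorem into the unique one.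
\<close>

lemma certificate_nonneg_iff_le_threshold:
  assumes "prob_space M" and dist: "distributed M lborel P (\<lambda>p. ennreal (f p))"
    and int: "integrable M (\<lambda>\<omega>. max (P \<omega>) 0)"
    and "0 \<le> \<phi>" and pos: "\<And>p. c < p \<Longrightarrow> 0 < f p"
    and thr: "threshold M P c A \<phi> = Some (ereal \<kappa>)"
  shows "0 \<le> certificate M P c A \<phi> K \<longleftrightarrow> K \<le> \<kappa>"
proof -
  let ?I = "certificate M P c A \<phi>"
  have meas: "P \<in> borel_measurable M"
    using distributed_measurable[OF dist] by simp
  note anti = certificate_antimono[OF assms(1) meas int \<open>0 \<le> \<phi>\<close>, of _ _ c A]
  obtain K\<^sub>1 K\<^sub>2 where K1: "?I K\<^sub>1 \<ge> 0" and K2: "?I K\<^sub>2 < 0"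
    and \<kappa>_eq: "\<kappa> = (THE \<kappa>. \<kappa> \<ge> c \<and> ?I \<kappa> = 0)"
    using thr by (auto simp: threshold_def not_less not_le split: if_splits)
  have "\<phi> \<noteq> 0"
  proof
    assume "\<phi> = 0"
    then have "?I K\<^sub>1 = ?I K\<^sub>2"
      by (simp add: certificate_eq)
    then show False
      using K1 K2 by simp
  qed
  with \<open>0 \<le> \<phi>\<close> have "\<phi> > 0"
    by simp
  have strict: "?I L < ?I K" if "c \<le> K" "K < L" for K L
    using that \<open>\<phi> > 0\<close> pos
    by (auto simp: certificate_eq max_absorb1
        intro!: call_payoff_strict_antimono[OF assms(1) meas int] upper_tail_positive[OF dist])
  have "?I c \<ge> 0"
  proof -
    have "?I (max K\<^sub>1 c) = ?I K\<^sub>1"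
      by (simp add: certificate_eq)
    then show ?thesis
      using anti[of c "max K\<^sub>1 c"] K1 by simp
  qed
  have "c \<le> K\<^sub>2"
    using \<open>?I c \<ge> 0\<close> K2 anti[of K\<^sub>2 c] by linarith
  have "continuous_on {c..K\<^sub>2} ?I"
    unfolding certificate_eq
    by (intro continuous_intros
        continuous_on_compose2[OF continuous_on_call_payoff[OF assms(1) meas int, of UNIV]]) auto
  then obtain \<kappa>' where \<kappa>': "c \<le> \<kappa>'" "?I \<kappa>' = 0"
    using IVT2'[of ?I K\<^sub>2 0 c] \<open>?I c \<ge> 0\<close> K2 \<open>c \<le> K\<^sub>2\<close> by auto
  have "\<kappa> = \<kappa>'"
    unfolding \<kappa>_eq
  proof (rule the_equality)
    fix x assume "c \<le> x \<and> ?I x = 0"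
    then show "x = \<kappa>'"
      using \<kappa>' strict[of x \<kappa>'] strict[of \<kappa>' x] by (cases x \<kappa>' rule: linorder_cases) auto
  qed (use \<kappa>' in auto)
  then show ?thesis
    using \<kappa>' anti[of K \<kappa>] strict[of \<kappa> K] by (cases "K \<le> \<kappa>") auto
qed

lemma threshold_cases:
  assumes "0 \<le> K" "0 \<le> certificate M P c A \<phi> K"
  obtains (infinite) "\<And>L. 0 \<le> L \<Longrightarrow> 0 \<le> certificate M P c A \<phi> L"
    | (finite) \<kappa> where "threshold M P c A \<phi> = Some (ereal \<kappa>)"
proof (cases "\<forall>L\<ge>0. 0 \<le> certificate M P c A \<phi> L")
  case True
  then show ?thesis using infinite by blast
next
  case False
  moreover have "\<not> (\<forall>L\<ge>0. certificate M P c A \<phi> L < 0)"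
    using assms not_less by blast
  ultimately show ?thesis
    using finite unfolding threshold_def by simp
qed

section \<open>Raising the strike\<close>

text \<open>
  Only the shape of the strikes that certify a resource matters here: all of them, or an initial
  segment ending at \<open>\<kappa> i\<close>. The flag \<open>has_threshold i\<close> marks the resources for which the value \<open>\<kappa> i\<close>
  has this meaning. The new strike is the least such \<open>\<kappa> i\<close> over the committed resources, so that none
  of them loses its certificate; without any such resource, boundedness would fail.
\<close>

lemma raise_to_threshold:
  assumes "finite G"
    and "(K, r, z) \<in> strike_feasible G I R"
    and "bdd_above (fst ` strike_feasible G I R)"
    and thresholds: "\<And>i. i \<in> G \<Longrightarrow> z i = 1 \<Longrightarrow>
      (\<forall>L\<ge>0. 0 \<le> I i L) \<or> has_threshold i \<and> (\<forall>L. 0 \<le> I i L \<longleftrightarrow> L \<le> \<kappa> i)"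
  obtains i where "i \<in> G" "has_threshold i" "K \<le> \<kappa> i" "(\<kappa> i, r, z) \<in> strike_feasible G I R"
proof -
  let ?T = "{i \<in> G. z i = 1 \<and> has_threshold i \<and> (\<forall>L. 0 \<le> I i L \<longleftrightarrow> L \<le> \<kappa> i)}"
  have feas: "\<And>i. i \<in> G \<Longrightarrow> z i = 1 \<Longrightarrow> 0 \<le> I i K" "r \<in> R z" "0 \<le> K" "z \<in> G \<rightarrow>\<^sub>E {0, 1}"
    using assms(2) by (auto simp: strike_feasible_def)
  have "?T \<noteq> {}"
  proof
    assume empty: "?T = {}"
    have "0 \<le> I i L" if "i \<in> G" "z i = 1" "0 \<le> L" for i L
      using thresholds[OF that(1,2)] that empty by blast
    then have "(L, r, z) \<in> strike_feasible G I R" if "0 \<le> L" for L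
      using feas(2,4) that by (simp add: strike_feasible_def)
    then have unbounded: "L \<in> fst ` strike_feasible G I R" if "0 \<le> L" for L
      using that by force
    obtain B where "\<And>x. x \<in> fst ` strike_feasible G I R \<Longrightarrow> x \<le> B"
      using assms(3) by (auto simp: bdd_above_def)
    from this[OF unbounded, of "max B 0 + 1"] show False
      by simp
  qed
  moreover have "finite ?T"
    using \<open>finite G\<close> by simp
  ultimately obtain i where i: "i \<in> ?T" and least: "\<And>j. j \<in> ?T \<Longrightarrow> \<kappa> i \<le> \<kappa> j"
    by (metis (no_types, lifting) Min_le finite_imageI imageI obtains_MIN)
  have "K \<le> \<kappa> i"
    using i feas(1) by auto
  have "0 \<le> I j (\<kappa> i)" if "j \<in> G" "z j = 1" for j
    using thresholds[OF that]
  proof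
    assume "\<forall>L\<ge>0. 0 \<le> I j L"
    then show ?thesis
      using \<open>0 \<le> K\<close> \<open>K \<le> \<kappa> i\<close> by simp
  next
    assume "has_threshold j \<and> (\<forall>L. 0 \<le> I j L \<longleftrightarrow> L \<le> \<kappa> j)"
    then show ?thesis
      using least[of j] that by simp
  qed
  then have "(\<kappa> i, r, z) \<in> strike_feasible G I R"
    using feas(2-4) \<open>K \<le> \<kappa> i\<close> by (auto simp: strike_feasible_def)
  moreover have "i \<in> G" "has_threshold i"
    using i by simp_all
  ultimately show ?thesis
    using that \<open>K \<le> \<kappa> i\<close> by blast
qed

section \<open>Optimality of a threshold\<close>

theorem theorem8:
  fixes M :: "'w measure" and P :: "'w \<Rightarrow> real" and f :: "real \<Rightarrow> real"
    and G :: "'g set" and Prods :: "'x reserve_product set"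
    and elig :: "'g \<Rightarrow> 'x reserve_product set"
    and Req :: "requirement \<Rightarrow> real"
    and Rmax :: "'g \<Rightarrow> 'x reserve_product \<Rightarrow> real" and R30 :: "'g \<Rightarrow> real"
    and c A \<phi> :: "'g \<Rightarrow> real"
  defines "F \<equiv> strike_feasible G (\<lambda>i. certificate M P (c i) (A i) (\<phi> i))
                 (reserve_feasible G elig Req Rmax R30)"
  assumes "finite G"
    and "finite Prods" and "{TMSR, TMNSR, TMOR} \<subseteq> Prods"
    and "\<And>i. i \<in> G \<Longrightarrow> elig i \<subseteq> Prods"
    and "prob_space M"
    and "\<And>p. f p \<ge> 0" and "distributed M lborel P (\<lambda>p. ennreal (f p))"
    and "integrable M (\<lambda>\<omega>. max (P \<omega>) 0)"
    and "\<And>i. i \<in> G \<Longrightarrow> c i \<ge> 0"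
    and "\<And>i. i \<in> G \<Longrightarrow> \<phi> i \<in> {0..1}"
    and "\<And>i p. i \<in> G \<Longrightarrow> p > c i \<Longrightarrow> f p > 0"
    and feasible: "F \<noteq> {}"
    and bounded: "bdd_above (fst ` F)"
  shows "\<exists>K r z. is_arg_max fst (\<lambda>s. s \<in> F) (K, r, z) \<and>
           (\<exists>i\<in>G. threshold M P (c i) (A i) (\<phi> i) = Some (ereal K))"
proof -
  define thr where "thr i = threshold M P (c i) (A i) (\<phi> i)" for i
  define \<kappa> where "\<kappa> i = real_of_ereal (the (thr i))" for i
  \<comment> \<open>\<open>\<kappa> i\<close> has an arbitrary value unless the threshold is finite, which is the first condition in \<open>C\<close>.\<close>
  define C where "C = {i \<in> G. thr i = Some (ereal (\<kappa> i)) \<and> (\<exists>r z. (\<kappa> i, r, z) \<in> F)}"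
  have dominated: "\<exists>i\<in>C. K \<le> \<kappa> i" if point: "(K, r, z) \<in> F" for K r z
  proof -
    have "(\<forall>L\<ge>0. 0 \<le> certificate M P (c i) (A i) (\<phi> i) L) \<or>
        thr i = Some (ereal (\<kappa> i)) \<and>
        (\<forall>L. 0 \<le> certificate M P (c i) (A i) (\<phi> i) L \<longleftrightarrow> L \<le> \<kappa> i)"
      if "i \<in> G" "z i = 1" for i
    proof -
      have "0 \<le> K" "0 \<le> certificate M P (c i) (A i) (\<phi> i) K"
        using point that by (auto simp: F_def strike_feasible_def)
      then show ?thesis
      proof (cases rule: threshold_cases)
        case infinite
        then show ?thesis by blast
      next
        case (finite k)
        then have "thr i = Some (ereal (\<kappa> i))"
          by (simp add: thr_def \<kappa>_def)
        moreover have "0 \<le> \<phi> i"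
          using assms(11)[OF \<open>i \<in> G\<close>] by simp
        ultimately show ?thesis
          using certificate_nonneg_iff_le_threshold[OF assms(6,8,9) _ assms(12)[OF \<open>i \<in> G\<close>]]
          unfolding thr_def by blast
      qed
    qed
    then obtain i where "i \<in> G" "thr i = Some (ereal (\<kappa> i))" "K \<le> \<kappa> i" "(\<kappa> i, r, z) \<in> F"
      unfolding F_def
      by (rule raise_to_threshold[OF \<open>finite G\<close> point[unfolded F_def] bounded[unfolded F_def]])
    then show ?thesis
      unfolding C_def by blast
  qed
  have "finite C"
    unfolding C_def using \<open>finite G\<close> by simp
  moreover have "C \<noteq> {}"
    using feasible dominated by fastforce
  ultimately obtain i where "i \<in> C" and greatest: "\<And>j. j \<in> C \<Longrightarrow> \<kappa> j \<le> \<kappa> i"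
    by (metis (no_types, lifting) Max_ge finite_imageI imageI obtains_MAX)
  then obtain r z where "i \<in> G" "thr i = Some (ereal (\<kappa> i))" "(\<kappa> i, r, z) \<in> F"
    unfolding C_def by blast
  moreover have "K \<le> \<kappa> i" if "(K, r', z') \<in> F" for K r' z'
    using dominated[OF that] greatest by force
  ultimately have "is_arg_max fst (\<lambda>s. s \<in> F) (\<kappa> i, r, z)"
    by (force simp: is_arg_max_def not_less)
  then show ?thesis
    using \<open>i \<in> G\<close> \<open>thr i = Some (ereal (\<kappa> i))\<close> unfolding thr_def by blast
qed

end
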